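(* If $\hat\Gamma(t)>1$ for some $t\in(0,1/2)$, then $p_A\ge t$ for any (nonempty) OR-closed set $A\subseteq\{0,1\}^n$.
   Context: Setting. $n\ge1$ is an integer. For $x,y\in\{0,1\}^n$, $x\vee y:=(x_i\vee y_i)_{i}$ is the coordinatewise OR. A set $A\subseteq\{0,1\}^n$ is OR-closed if $x\vee y\in A$ for all $x,y\in A$. For a nonempty $A\subseteq\{0,1\}^n$, let $X^n=(X_1,\dots,X_n)$ be uniformly distributed on $A$ and set $p_A:=\max_{1\le i\le n}\Pr(X_i=1)$. Binary entropy: $h(a)=-a\log_2 a-(1-a)\log_2(1-a)$ for $a\in[0,1]$ (with $0\log_2 0=0$). For $p,q\in[0,1]$ let $\varphi(1,p,q):=\mathrm{median}\{\max\{p,q\},1/2,p+q\}$, the median of the three listed numbers regarded as a multiset. For a symmetric finitely supported distribution $P_{pq}$ on $[0,1]^2$ (i.e. $P_{pq}(x,y)=P_{pq}(y,x)$) with marginal $P_p$, and $\alpha\in[0,1]$, let $$g(P_{pq},\alpha):=(1-\alpha)\,\mathbb E_{(p,q)\sim P_p^{\otimes 2}}h(p+q-pq)+\alpha\,\mathbb E_{(p,q)\sim P_{pq}}h(\varphi(1,p,q)),$$ where $P_p^{\otimes 2}$ is the product measure $P_p\otimes P_p$. Let $Q_{x,y}:=\frac12\delta_{(x,y)}+\frac12\delta_{(y,x)}$, where $\delta_{(x,y)}$ is the Dirac measure at $(x,y)$. For $t\in(0,1/2)$ define $$\hat\Gamma(t):=\sup_{\alpha\in[0,1]}\ \inf_{P_{pq}}\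 \frac{g(P_{pq},\alpha)}{\mathbb E h(p)},$$ where the infimum is taken over all (symmetric) distributions $P_{pq}$ with $\mathbb E h(p)>0$ (with $p$ distributed as the first marginal $P_p$ of $P_{pq}$) of the form $(1-\beta)Q_{a_1,a_2}+\beta Q_{b_1,b_2}$ with $a_1,a_2,b_1,b_2\in[0,1]$ such that $0\le a:=\frac{a_1+a_2}{2}\le t<b:=\frac{b_1+b_2}{2}\le1$, and with $\beta=0$ or $\beta=\frac{t-a}{b-a}>0$.
   Formalization: The formal theorem additionally assumes that A is not the set consisting only of the all-zero vector; for that set p_A = 0, so the claim as printed fails (for instance at t = 0.1, where Γ̂(t) > 1). *)

theory Defs
  imports "HOL-Probability.Probability"
begin

text \<open>The cube \<open>{0,1}^n\<close> is the set of extensional functions from \<open>{1..n}\<close> to \<open>bool\<close>;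
  \<open>True\<close> plays the role of 1.\<close>

definition cube :: "nat \<Rightarrow> (nat \<Rightarrow> bool) set" where
  "cube n = {1..n} \<rightarrow>\<^sub>E UNIV"

definition or_vec :: "nat \<Rightarrow> (nat \<Rightarrow> bool) \<Rightarrow> (nat \<Rightarrow> bool) \<Rightarrow> (nat \<Rightarrow> bool)" where
  "or_vec n x y = (\<lambda>i\<in>{1..n}. x i \<or> y i)"

definition zero_vec :: "nat \<Rightarrow> (nat \<Rightarrow> bool)" where
  "zero_vec n = (\<lambda>i\<in>{1..n}. False)"

definition or_closed :: "nat \<Rightarrow> (nat \<Rightarrow> bool) set \<Rightarrow> bool" where
  "or_closed n A \<longleftrightarrow> (\<forall>x\<in>A. \<forall>y\<in>A. or_vec n x y \<in> A)"

definition max_freq :: "nat \<Rightarrow> (nat \<Rightarrow> bool) set \<Rightarrow> real" where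
  "max_freq n A = Max ((\<lambda>i. measure_pmf.prob (pmf_of_set A) {x. x i}) ` {1..n})"

definition binary_entropy :: "real \<Rightarrow> real" where
  "binary_entropy a = - a * log 2 a - (1 - a) * log 2 (1 - a)"

definition median3 :: "real \<Rightarrow> real \<Rightarrow> real \<Rightarrow> real" where
  "median3 x y z = sort [x, y, z] ! 1"

text \<open>The function \<open>\<phi>(1, p, q)\<close>.\<close>

definition phi1 :: "real \<Rightarrow> real \<Rightarrow> real" where
  "phi1 p q = median3 (max p q) (1/2) (p + q)"

definition marginal :: "(real \<times> real) pmf \<Rightarrow> real pmf" where
  "marginal P = map_pmf fst P"

definition mean_entropy :: "(real \<times> real) pmf \<Rightarrow> real" where
  "mean_entropy P = measure_pmf.expectation (marginal P) binary_entropy"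

definition g_fun :: "(real \<times> real) pmf \<Rightarrow> real \<Rightarrow> real" where
  "g_fun P \<alpha> =
     (1 - \<alpha>) * measure_pmf.expectation (pair_pmf (marginal P) (marginal P))
                 (\<lambda>(p, q). binary_entropy (p + q - p * q))
     + \<alpha> * measure_pmf.expectation P (\<lambda>(p, q). binary_entropy (phi1 p q))"

definition mixture :: "real \<Rightarrow> 'a pmf \<Rightarrow> 'a pmf \<Rightarrow> 'a pmf" where
  "mixture \<beta> M N = bernoulli_pmf \<beta> \<bind> (\<lambda>c. if c then N else M)"

lemma pmf_mixture:
  assumes "0 \<le> \<beta>" "\<beta> \<le> 1"
  shows "pmf (mixture \<beta> M N) z = (1 - \<beta>) * pmf M z + \<beta> * pmf N z"
  using assms by (simp add: mixture_def pmf_bind)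

definition Q_dist :: "real \<Rightarrow> real \<Rightarrow> (real \<times> real) pmf" where
  "Q_dist x y = mixture (1/2) (return_pmf (x, y)) (return_pmf (y, x))"

definition admissible :: "real \<Rightarrow> (real \<times> real) pmf set" where
  "admissible t = {P. \<exists>a1\<in>{0..1}. \<exists>a2\<in>{0..1}. \<exists>b1\<in>{0..1}. \<exists>b2\<in>{0..1}. \<exists>a b \<beta>.
     a = (a1 + a2) / 2 \<and> b = (b1 + b2) / 2 \<and> 0 \<le> a \<and> a \<le> t \<and> t < b \<and> b \<le> 1 \<and>
     (\<beta> = 0 \<or> \<beta> = (t - a) / (b - a) \<and> \<beta> > 0) \<and>
     P = mixture \<beta> (Q_dist a1 a2) (Q_dist b1 b2) \<and> mean_entropy P > 0}"

text \<open>Taking values in \<^typ>\<open>ereal\<close> makes the supremum and infimum total; no extended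
  value actually arises for \<open>0 < t < 1/2\<close>.\<close>

definition Gamma_hat :: "real \<Rightarrow> ereal" where
  "Gamma_hat t = (SUP \<alpha>\<in>{0..1}. INF P\<in>admissible t. ereal (g_fun P \<alpha> / mean_entropy P))"

end

theory Submission imports Defs begin

text \<open>
  Suppose that every coordinate is 1 with frequency below \<open>t\<close>, and write \<open>h\<close> for the binary entropy.
  Reveal two uniform elements \<open>X\<close> and \<open>Y\<close> of \<open>A\<close> one coordinate at a time. Before each step let \<open>p\<close>
  and \<open>q\<close> be the probabilities that the next bit of \<open>X\<close>, respectively \<open>Y\<close>, is 1 given its own
  prefix, and couple the two bits so that their OR is 1 with probability \<open>\<psi> p q\<close>. Any value between
  \<open>max p q\<close> and \<open>min 1 (p + q)\<close> is possible. As \<open>A\<close> is OR-closed, \<open>X \<or> Y\<close> stays in \<open>A\<close>, and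
  comparing each of its bits with the corresponding bit of a uniform element of \<open>A\<close> by Gibbs'
  inequality shows that the sum over the coordinates of the means of \<open>h (\<psi> p q)\<close> is at most
  \<open>log 2 (card A)\<close> (\<open>or_entropy_sum_le\<close>). By the chain rule the sum of the means of \<open>h p\<close> is equal to
  \<open>log 2 (card A)\<close> (\<open>entropy_chain_rule\<close>).

  The choice \<open>\<psi> p q = p + q - p q\<close> makes \<open>X\<close> and \<open>Y\<close> independent, and \<open>\<psi> = phi1\<close> pushes the
  entropy of each bit as high as a coupling allows. The average of the two bounds with weights \<open>1 - \<alpha>\<close>
  and \<open>\<alpha>\<close> says that the values of \<open>g_fun\<close> at the joint laws of \<open>(p, q)\<close> in the successive steps sum to at
  most \<open>log 2 (card A)\<close> (\<open>sum_g_fun_le\<close>). If \<open>g_fun\<close> is at least \<open>c > 1\<close> times the mean entropy at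
  each of these laws, this contradicts the chain rule, because \<open>A\<close> has at least two elements.

  The hypothesis on \<open>Gamma_hat\<close> gives such a bound only for mixtures of two laws \<open>Q_dist\<close>. It extends
  to every finitely supported symmetric law of mean below \<open>t\<close> in two moves. An atom at \<open>(1, 1)\<close>
  raises the mean to \<open>t\<close> and makes the inequality stronger (\<open>g_ge_mean_entropy\<close>). The enlarged law
  decomposes into mixtures of two \<open>Q_dist\<close> that each have mean \<open>t\<close> (\<open>two_point_decomposition\<close>), and at fixed mean \<open>g_fun\<close> is
  concave (\<open>product_entropy_concave\<close>): expanding \<open>h (p + q - p q)\<close> in powers of \<open>(1 - p) (1 - q)\<close>
  leaves, apart from affine terms, only negative multiples of squared moments.
\<close>

section \<open>Expectations under finitely supported laws\<close>

abbreviation expect :: "'a pmf \<Rightarrow> ('a \<Rightarrow> real) \<Rightarrow> real" where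
  "expect M f \<equiv> measure_pmf.expectation M f"

lemma expect_finite:
  assumes "finite (set_pmf M)"
  shows "expect M f = (\<Sum>x\<in>set_pmf M. pmf M x * f x)"
  by (subst integral_measure_pmf[OF assms]) auto

lemma expect_bind:
  assumes "finite (set_pmf M)" "\<And>x. x \<in> set_pmf M \<Longrightarrow> finite (set_pmf (N x))"
  shows "expect (M \<bind> N) f = expect M (\<lambda>x. expect (N x) f)"
  using assms by (subst pmf_expectation_bind[OF assms(1)]) (auto simp: expect_finite[OF assms(1)])

lemma expect_pair:
  assumes "finite (set_pmf M)" "finite (set_pmf N)"
  shows "expect (pair_pmf M N) f = expect M (\<lambda>x. expect N (\<lambda>y. f (x, y)))"
proof -
  have "expect (pair_pmf M N) f = expect M (\<lambda>x. expect (N \<bind> (\<lambda>y. return_pmf (x, y))) f)"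
    unfolding pair_pmf_def using assms by (subst expect_bind) auto
  also have "\<dots> = expect M (\<lambda>x. expect N (\<lambda>y. f (x, y)))"
    by (simp add: map_pmf_def[symmetric])
  finally show ?thesis .
qed

lemma expect_cong:
  assumes "\<And>x. x \<in> set_pmf M \<Longrightarrow> f x = g x"
  shows "expect M f = expect M g"
  using assms by (intro integral_cong_AE) (auto simp: AE_measure_pmf_iff)

lemma expect_mono:
  assumes "finite (set_pmf M)" "\<And>x. x \<in> set_pmf M \<Longrightarrow> f x \<le> g x"
  shows "expect M f \<le> expect M g"
  unfolding expect_finite[OF assms(1)] using assms(2)
  by (intro sum_mono mult_left_mono) auto

lemma expect_nonneg:
  assumes "\<And>x. x \<in> set_pmf M \<Longrightarrow> 0 \<le> f x"
  shows "0 \<le> expect M f"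
  using assms by (intro integral_nonneg_AE) (auto simp: AE_measure_pmf_iff)

lemma set_mixture:
  "set_pmf (mixture \<beta> M N) \<subseteq> set_pmf M \<union> set_pmf N"
  by (auto simp: mixture_def split: if_splits)

lemma finite_mixture [intro]:
  assumes "finite (set_pmf M)" "finite (set_pmf N)"
  shows "finite (set_pmf (mixture \<beta> M N))"
  using assms set_mixture finite_subset by (metis finite_UnI)

lemma expect_mixture:
  assumes "0 \<le> \<beta>" "\<beta> \<le> 1" "finite (set_pmf M)" "finite (set_pmf N)"
  shows "expect (mixture \<beta> M N) f = (1 - \<beta>) * expect M f + \<beta> * expect N f"
  using assms unfolding mixture_def by (subst expect_bind) auto

lemma map_mixture: "map_pmf f (mixture \<beta> M N) = mixture \<beta> (map_pmf f M) (map_pmf f N)"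
  by (simp add: mixture_def map_bind_pmf if_distrib cong: if_cong)

lemma finite_Q_dist [simp]: "finite (set_pmf (Q_dist x y))"
  by (auto simp: Q_dist_def)

lemma set_Q_dist: "set_pmf (Q_dist x y) \<subseteq> {(x, y), (y, x)}"
  using set_mixture unfolding Q_dist_def by fastforce

lemma expect_Q_dist: "expect (Q_dist x y) f = (f (x, y) + f (y, x)) / 2"
  by (simp add: Q_dist_def expect_mixture)

section \<open>Binary entropy\<close>

lemma binary_entropy_0 [simp]: "binary_entropy 0 = 0"
  and binary_entropy_1 [simp]: "binary_entropy 1 = 0"
  by (simp_all add: binary_entropy_def)

lemma binary_entropy_nonneg:
  assumes "0 \<le> a" "a \<le> 1"
  shows "0 \<le> binary_entropy a"
proof -
  have "x * log 2 x \<le> 0" if "0 \<le> x" "x \<le> 1" for x :: real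
    using that by (cases "x = 0") (auto intro!: mult_nonneg_nonpos)
  from this[of a] this[of "1 - a"] assms show ?thesis
    unfolding binary_entropy_def by auto
qed

text \<open>The tangent bound \<open>ln x \<le> x - 1\<close> at \<open>x = r / a\<close>. In Gibbs' inequality it is used for both
  outcomes of a bit, and there the two right-hand sides cancel.\<close>

lemma log_le_tangent:
  assumes "0 \<le> a" "0 \<le> r" "a > 0 \<Longrightarrow> r > 0"
  shows "a * log 2 r - a * log 2 a \<le> (r - a) / ln 2"
proof (cases "a = 0")
  case False
  then have pos: "a > 0" "r > 0" using assms by auto
  have "a * ln (r / a) \<le> a * (r / a - 1)"
    using pos by (intro mult_left_mono ln_le_minus_one) auto
  also have "\<dots> = r - a" using pos by (simp add: field_simps)
  finally have "a * ln r - a * ln a \<le> r - a"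
    using pos by (simp add: ln_div right_diff_distrib)
  then have "(a * ln r - a * ln a) / ln 2 \<le> (r - a) / ln 2"
    by (intro divide_right_mono) auto
  then show ?thesis by (simp add: log_def diff_divide_distrib)
qed (use assms in auto)

text \<open>Gibbs' inequality for one bit. The conditions on \<open>r\<close> exclude infinite cross entropy, which the
  convention \<open>log 2 0 = 0\<close> would otherwise turn into a false bound.\<close>

lemma binary_entropy_le_cross_entropy:
  assumes "0 \<le> a" "a \<le> 1" "0 \<le> r" "r \<le> 1" "a > 0 \<Longrightarrow> r > 0" "a < 1 \<Longrightarrow> r < 1"
  shows "binary_entropy a \<le> - a * log 2 r - (1 - a) * log 2 (1 - r)"
proof -
  have "a * log 2 r - a * log 2 a + ((1 - a) * log 2 (1 - r) - (1 - a) * log 2 (1 - a))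
      \<le> (r - a) / ln 2 + ((1 - r) - (1 - a)) / ln 2"
    using assms by (intro add_mono log_le_tangent) auto
  also have "\<dots> = 0" by (simp add: field_simps)
  finally show ?thesis unfolding binary_entropy_def by simp
qed

section \<open>The OR of two independent bits and concavity at fixed mean\<close>

text \<open>Integrating \<open>- ln (1 - x) = x + x^2 / 2 + \<dots>\<close> once more. All coefficients are
  nonnegative, which is the source of the concavity below. At \<open>x = 1\<close> the series telescopes, and the
  right-hand side is \<open>1\<close> because the factor \<open>1 - x\<close> kills the logarithm.\<close>

lemma x_plus_one_minus_x_ln_sums:
  fixes x :: real
  assumes "0 \<le> x" "x \<le> 1"
  shows "(\<lambda>k. x ^ (k + 2) / real ((k + 1) * (k + 2))) sums (x + (1 - x) * ln (1 - x))"
proof (cases "x = 1")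
  case True
  have "(\<lambda>k. 1 / real (k + 1) - 1 / real (Suc k + 1)) sums (1 / real (0 + 1) - 0)"
    by (rule telescope_sums') real_asymp
  moreover have "1 / real (k + 1) - 1 / real (Suc k + 1) = 1 / real ((k + 1) * (k + 2))" for k
    by (simp add: field_simps)
  ultimately show ?thesis using True by (simp only: power_one) simp
next
  case False
  then have x: "\<bar>x\<bar> < 1" using assms by auto
  have "(\<lambda>n. - ((x ^ n) / real n)) sums ln (1 - x)"
    using ln_series'[of "-x"] x by (simp)
  then have L: "(\<lambda>n. x ^ n / real n) sums (- ln (1 - x))"
    using sums_minus by fastforce
  have L1: "(\<lambda>k. x ^ (k + 1) / real (k + 1)) sums (- ln (1 - x))"
    using L sums_Suc_iff[of "\<lambda>n. x ^ n / real n" "- ln (1 - x)"] by simp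
  have L2: "(\<lambda>k. x ^ (k + 2) / real (k + 2)) sums (- ln (1 - x) - x)"
    using L1 sums_Suc_iff[of "\<lambda>k. x ^ (k + 1) / real (k + 1)" "- ln (1 - x) - x"] by simp
  have "(\<lambda>k. x * (x ^ (k + 1) / real (k + 1)) - x ^ (k + 2) / real (k + 2))
      sums (x * (- ln (1 - x)) - (- ln (1 - x) - x))"
    by (intro sums_diff sums_mult L1 L2)
  moreover have "x * (x ^ (k + 1) / real (k + 1)) - x ^ (k + 2) / real (k + 2)
      = x ^ (k + 2) / real ((k + 1) * (k + 2))" for k
  proof -
    have "1 / real (k + 1) - 1 / real (k + 2) = 1 / real ((k + 1) * (k + 2))"
      by (simp add: field_simps)
    then have "x ^ (k + 2) * (1 / real (k + 1) - 1 / real (k + 2)) = x ^ (k + 2) / real ((k + 1) * (k + 2))"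
      by simp
    then show ?thesis by (simp only: right_diff_distrib) simp
  qed
  moreover have "x * (- ln (1 - x)) - (- ln (1 - x) - x) = x + (1 - x) * ln (1 - x)"
    by (simp add: algebra_simps)
  ultimately show ?thesis by (simp only:)
qed

text \<open>With \<open>u = 1 - p\<close> and \<open>v = 1 - q\<close> the OR of two independent bits is 0 with probability \<open>u v\<close>.
  Since \<open>u v ln (u v) = u (v ln v) + (u ln u) v\<close>, the entropy \<open>h (1 - u v)\<close> becomes a sum of
  products of a function of \<open>p\<close> and a function of \<open>q\<close>. This separation lets the product measure
  factor.\<close>

lemma or_entropy_sums:
  fixes p q :: real
  assumes "0 \<le> p" "p \<le> 1" "0 \<le> q" "q \<le> 1"
  shows "(\<lambda>k. (1 - p) ^ (k + 2) * (1 - q) ^ (k + 2) / real ((k + 1) * (k + 2))) sums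
     ((1 - p) * (1 - q) - (1 - p) * ((1 - q) * ln (1 - q)) - (1 - p) * ln (1 - p) * (1 - q)
       - ln 2 * binary_entropy (p + q - p * q))"
proof -
  define u v where "u = 1 - p" and "v = 1 - q"
  have uv: "0 \<le> u" "u \<le> 1" "0 \<le> v" "v \<le> 1" using assms by (auto simp: u_def v_def)
  have s: "(\<lambda>k. (u * v) ^ (k + 2) / real ((k + 1) * (k + 2))) sums (u * v + (1 - u * v) * ln (1 - u * v))"
    using uv by (intro x_plus_one_minus_x_ln_sums mult_nonneg_nonneg mult_le_one) auto
  have ln_prod: "u * v * ln (u * v) = u * (v * ln v) + u * ln u * v"
  proof (cases "u = 0 \<or> v = 0")
    case False
    then show ?thesis using uv by (simp add: ln_mult algebra_simps)
  qed auto
  have pq: "p + q - p * q = 1 - u * v" by (simp add: u_def v_def algebra_simps)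
  have "ln 2 * binary_entropy (p + q - p * q) = - (1 - u * v) * ln (1 - u * v) - u * v * ln (u * v)"
    unfolding pq binary_entropy_def log_def by (simp add: field_simps)
  then have eq: "u * v + (1 - u * v) * ln (1 - u * v)
     = u * v - u * (v * ln v) - u * ln u * v - ln 2 * binary_entropy (p + q - p * q)"
    unfolding ln_prod by (simp add: algebra_simps)
  show ?thesis
    using s unfolding eq u_def[symmetric] v_def[symmetric] by (simp only: power_mult_distrib)
qed

definition product_entropy :: "real pmf \<Rightarrow> real" where
  "product_entropy M = expect (pair_pmf M M) (\<lambda>(p, q). binary_entropy (p + q - p * q))"

text \<open>Every separated product integrates to a product of two expectations, so the entropy is
  expressed by \<open>E u\<close>, \<open>E (u ln u)\<close> and the squared moments \<open>(E u^k)^2\<close> of \<open>u = 1 - p\<close>.\<close>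

lemma product_entropy_sums:
  assumes fin: "finite (set_pmf M)" and M: "set_pmf M \<subseteq> {0..1}"
  shows "(\<lambda>k. (expect M (\<lambda>p. (1 - p) ^ (k + 2)))\<^sup>2 / real ((k + 1) * (k + 2))) sums
     ((expect M (\<lambda>p. 1 - p))\<^sup>2 - 2 * expect M (\<lambda>p. 1 - p) * expect M (\<lambda>p. (1 - p) * ln (1 - p))
       - ln 2 * product_entropy M)"
proof -
  let ?S = "set_pmf M" and ?w = "pmf M"
  have prod: "(\<Sum>p\<in>?S. \<Sum>q\<in>?S. ?w p * ?w q * (f p * g q)) = expect M f * expect M g" for f g
    unfolding expect_finite[OF fin] sum_product by (simp add: mult_ac)
  have "(\<lambda>k. \<Sum>p\<in>?S. \<Sum>q\<in>?S. ?w p * ?w q *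
           ((1 - p) ^ (k + 2) * (1 - q) ^ (k + 2) / real ((k + 1) * (k + 2)))) sums
        (\<Sum>p\<in>?S. \<Sum>q\<in>?S. ?w p * ?w q *
           ((1 - p) * (1 - q) - (1 - p) * ((1 - q) * ln (1 - q)) - (1 - p) * ln (1 - p) * (1 - q)
       - ln 2 * binary_entropy (p + q - p * q)))"
    using M by (intro sums_sum sums_mult or_entropy_sums) auto
  also have "(\<lambda>k. \<Sum>p\<in>?S. \<Sum>q\<in>?S. ?w p * ?w q *
           ((1 - p) ^ (k + 2) * (1 - q) ^ (k + 2) / real ((k + 1) * (k + 2))))
    = (\<lambda>k. (expect M (\<lambda>p. (1 - p) ^ (k + 2)))\<^sup>2 / real ((k + 1) * (k + 2)))"
    unfolding power2_eq_square prod[symmetric] sum_divide_distrib by simp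
  also have "(\<Sum>p\<in>?S. \<Sum>q\<in>?S. ?w p * ?w q *
           ((1 - p) * (1 - q) - (1 - p) * ((1 - q) * ln (1 - q)) - (1 - p) * ln (1 - p) * (1 - q)
       - ln 2 * binary_entropy (p + q - p * q)))
    = (expect M (\<lambda>p. 1 - p))\<^sup>2 - expect M (\<lambda>p. 1 - p) * expect M (\<lambda>p. (1 - p) * ln (1 - p))
      - expect M (\<lambda>p. (1 - p) * ln (1 - p)) * expect M (\<lambda>p. 1 - p)
       - ln 2 * (\<Sum>p\<in>?S. \<Sum>q\<in>?S. ?w p * ?w q * binary_entropy (p + q - p * q))"
    unfolding power2_eq_square prod[symmetric] sum_subtractf right_diff_distrib sum_distrib_left
    by (simp add: mult_ac)
  also have "(\<Sum>p\<in>?S. \<Sum>q\<in>?S. ?w p * ?w q * binary_entropy (p + q - p * q)) = product_entropy M"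
    unfolding product_entropy_def expect_pair[OF fin fin]
    by (simp add: expect_finite[OF fin] sum_distrib_left mult_ac)
  finally show ?thesis by (simp add: mult_ac)
qed

lemma weighted_square_le:
  fixes w x :: "'i \<Rightarrow> real"
  assumes "finite I" "\<And>i. i \<in> I \<Longrightarrow> 0 \<le> w i" "(\<Sum>i\<in>I. w i) = 1"
  shows "(\<Sum>i\<in>I. w i * x i)\<^sup>2 \<le> (\<Sum>i\<in>I. w i * (x i)\<^sup>2)"
proof -
  define m where "m = (\<Sum>i\<in>I. w i * x i)"
  have "0 \<le> (\<Sum>i\<in>I. w i * (x i - m)\<^sup>2)"
    using assms by (intro sum_nonneg mult_nonneg_nonneg) auto
  also have "\<dots> = (\<Sum>i\<in>I. w i * (x i)\<^sup>2) - 2 * m * (\<Sum>i\<in>I. w i * x i) + m\<^sup>2 * (\<Sum>i\<in>I. w i)"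
    by (simp add: power2_diff algebra_simps sum.distrib sum_subtractf sum_distrib_left sum_distrib_right)
  also have "\<dots> = (\<Sum>i\<in>I. w i * (x i)\<^sup>2) - m\<^sup>2"
    unfolding assms(3) m_def[symmetric] by (simp add: power2_eq_square)
  finally show ?thesis unfolding m_def by simp
qed

text \<open>Once \<open>E u\<close> is fixed, the terms \<open>(E u)^2\<close> and \<open>E u * E (u ln u)\<close> depend affinely on the
  law of \<open>p\<close>, and each squared moment is convex in it. The squared moments enter the entropy with
  negative sign, so what remains is concave. Equality of the means is essential here: without it the
  product \<open>E u * E (u ln u)\<close> is not affine.\<close>

lemma product_entropy_concave:
  fixes V :: "'i \<Rightarrow> real pmf" and w :: "'i \<Rightarrow> real"
  assumes I: "finite I" and w: "\<And>i. i \<in> I \<Longrightarrow> 0 \<le> w i"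
    and V: "\<And>i. i \<in> I \<Longrightarrow> finite (set_pmf (V i)) \<and> set_pmf (V i) \<subseteq> {0..1}"
    and mean: "\<And>i. i \<in> I \<Longrightarrow> expect (V i) (\<lambda>p. p) = m"
    and M: "finite (set_pmf M)" "set_pmf M \<subseteq> {0..1}"
    and dec: "\<And>f. expect M f = (\<Sum>i\<in>I. w i * expect (V i) f)"
  shows "(\<Sum>i\<in>I. w i * product_entropy (V i)) \<le> product_entropy M"
proof -
  have w1: "(\<Sum>i\<in>I. w i) = 1" using dec[of "\<lambda>_. 1"] by simp
  have u: "expect (V i) (\<lambda>p. 1 - p) = 1 - m" if "i \<in> I" for i
    using V[OF that] mean[OF that]
    by (subst Bochner_Integration.integral_diff) (auto intro: integrable_measure_pmf_finite)
  have uM: "expect M (\<lambda>p. 1 - p) = 1 - m"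
    unfolding dec using u w1 by (simp add: sum_distrib_right[symmetric])
  define l where "l N = expect N (\<lambda>p. (1 - p) * ln (1 - p))" for N
  have lM: "l M = (\<Sum>i\<in>I. w i * l (V i))" unfolding l_def by (rule dec)
  have "(1 - m)\<^sup>2 - 2 * (1 - m) * l M - ln 2 * product_entropy M
      \<le> (\<Sum>i\<in>I. w i * ((1 - m)\<^sup>2 - 2 * (1 - m) * l (V i) - ln 2 * product_entropy (V i)))"
  proof (rule sums_le)
    show "(\<lambda>k. (expect M (\<lambda>p. (1 - p) ^ (k + 2)))\<^sup>2 / real ((k + 1) * (k + 2))) sums
        ((1 - m)\<^sup>2 - 2 * (1 - m) * l M - ln 2 * product_entropy M)"
      using product_entropy_sums[OF M] unfolding uM l_def .
    have "(\<lambda>k. (expect (V i) (\<lambda>p. (1 - p) ^ (k + 2)))\<^sup>2 / real ((k + 1) * (k + 2))) sums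
        ((1 - m)\<^sup>2 - 2 * (1 - m) * l (V i) - ln 2 * product_entropy (V i))" if "i \<in> I" for i
      using product_entropy_sums[of "V i"] V[OF that] unfolding u[OF that] l_def by blast
    then show "(\<lambda>k. \<Sum>i\<in>I. w i * ((expect (V i) (\<lambda>p. (1 - p) ^ (k + 2)))\<^sup>2 / real ((k + 1) * (k + 2)))) sums
        (\<Sum>i\<in>I. w i * ((1 - m)\<^sup>2 - 2 * (1 - m) * l (V i) - ln 2 * product_entropy (V i)))"
      by (intro sums_sum sums_mult) auto
    show "(expect M (\<lambda>p. (1 - p) ^ (k + 2)))\<^sup>2 / real ((k + 1) * (k + 2))
      \<le> (\<Sum>i\<in>I. w i * ((expect (V i) (\<lambda>p. (1 - p) ^ (k + 2)))\<^sup>2 / real ((k + 1) * (k + 2))))" for k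
      using divide_right_mono[OF weighted_square_le[OF I w w1,
          of "\<lambda>i. expect (V i) (\<lambda>p. (1 - p) ^ (k + 2))"], of "real ((k + 1) * (k + 2))"]
      unfolding dec[of "\<lambda>p. (1 - p) ^ (k + 2)"] sum_divide_distrib by simp
  qed
  also have "\<dots> = (1 - m)\<^sup>2 - 2 * (1 - m) * l M - ln 2 * (\<Sum>i\<in>I. w i * product_entropy (V i))"
    unfolding lM right_diff_distrib sum_subtractf sum_distrib_right[symmetric] w1
    by (simp add: sum_distrib_left mult_ac)
  finally show ?thesis by simp
qed

section \<open>The two entropy terms of the functional\<close>

lemma phi1_commute: "phi1 p q = phi1 q p"
  by (simp add: phi1_def max.commute add.commute)

text \<open>The median is the point of the interval from \<open>max p q\<close> to \<open>min 1 (p + q)\<close> closest to \<open>1/2\<close>. This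
  interval consists of the probabilities that the OR of two bits with biases \<open>p\<close> and \<open>q\<close> can have.\<close>

lemma phi1_bounds:
  assumes "0 \<le> p" "p \<le> 1" "0 \<le> q" "q \<le> 1"
  shows "max p q \<le> phi1 p q" "phi1 p q \<le> min 1 (p + q)"
  using assms by (auto simp: phi1_def median3_def max_def min_def)

lemma or_prob_bounds:
  fixes p q :: real
  assumes "0 \<le> p" "p \<le> 1" "0 \<le> q" "q \<le> 1"
  shows "max p q \<le> p + q - p * q" "p + q - p * q \<le> min 1 (p + q)"
proof -
  have "0 \<le> (1 - p) * q" "0 \<le> (1 - q) * p" "0 \<le> (1 - p) * (1 - q)" "0 \<le> p * q"
    using assms by simp_all
  then show "max p q \<le> p + q - p * q" "p + q - p * q \<le> min 1 (p + q)"
    by (auto simp: algebra_simps)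
qed

lemma product_entropy_nonneg:
  assumes "set_pmf M \<subseteq> {0..1}"
  shows "0 \<le> product_entropy M"
  unfolding product_entropy_def
proof (rule expect_nonneg, clarsimp)
  fix p q assume "p \<in> set_pmf M" "q \<in> set_pmf M"
  then have "0 \<le> p" "p \<le> 1" "0 \<le> q" "q \<le> 1" using assms by auto
  from or_prob_bounds[OF this] this show "0 \<le> binary_entropy (p + q - p * q)"
    by (intro binary_entropy_nonneg) auto
qed

lemma expect_marginal: "expect (marginal P) f = expect P (\<lambda>z. f (fst z))"
  by (simp add: marginal_def)

lemma marginal_unit_interval:
  assumes "set_pmf P \<subseteq> {0..1} \<times> {0..1}"
  shows "set_pmf (marginal P) \<subseteq> {0..1}"
  using assms by (auto simp: marginal_def)

lemma g_fun_eq: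
  "g_fun P \<alpha> = (1 - \<alpha>) * product_entropy (marginal P)
     + \<alpha> * expect P (\<lambda>(p, q). binary_entropy (phi1 p q))"
  by (simp add: g_fun_def product_entropy_def)

lemma mean_entropy_eq: "mean_entropy P = expect P (\<lambda>z. binary_entropy (fst z))"
  by (simp add: mean_entropy_def expect_marginal)

lemma phi1_entropy_nonneg:
  assumes "set_pmf P \<subseteq> {0..1} \<times> {0..1}"
  shows "0 \<le> expect P (\<lambda>(p, q). binary_entropy (phi1 p q))"
proof (rule expect_nonneg, clarify)
  fix p q assume "(p, q) \<in> set_pmf P"
  then have "0 \<le> p" "p \<le> 1" "0 \<le> q" "q \<le> 1" using assms by auto
  from phi1_bounds[OF this] this show "0 \<le> binary_entropy (phi1 p q)"
    by (intro binary_entropy_nonneg) auto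
qed

lemma g_fun_nonneg:
  assumes "set_pmf P \<subseteq> {0..1} \<times> {0..1}" "0 \<le> \<alpha>" "\<alpha> \<le> 1"
  shows "0 \<le> g_fun P \<alpha>"
  unfolding g_fun_eq using assms
  by (intro add_nonneg_nonneg mult_nonneg_nonneg product_entropy_nonneg phi1_entropy_nonneg
      marginal_unit_interval) auto

section \<open>Reduction to mixtures of two symmetrized atoms\<close>

text \<open>A weighting whose \<open>m\<close>-average is \<open>t\<close>, with some point above \<open>t\<close>, is a mixture of pairs, one point with \<open>m x \<le> t\<close> and
  one with \<open>m y > t\<close>, each pair balanced so that its own average is \<open>t\<close>. Choosing the pair \<open>(x, y)\<close>
  with weight proportional to \<open>w x * w y * (m y - m x)\<close> works because the deficit on the low side
  equals the excess \<open>D\<close> on the high side.\<close>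

lemma two_point_decomposition:
  fixes w m F :: "'a \<Rightarrow> real"
  assumes S: "finite S" and mean: "(\<Sum>x\<in>S. w x * (m x - t)) = 0"
    and w: "\<And>x. x \<in> S \<Longrightarrow> 0 < w x" and ex: "x0 \<in> S" "t < m x0"
  defines "L \<equiv> {x\<in>S. m x \<le> t}" and "H \<equiv> {x\<in>S. t < m x}"
  defines "D \<equiv> (\<Sum>y\<in>H. w y * (m y - t))"
  shows "0 < D"
    and "(\<Sum>x\<in>S. w x * F x) = (\<Sum>(x, y)\<in>L \<times> H. w x * w y * (m y - m x) / D *
       ((1 - (t - m x) / (m y - m x)) * F x + (t - m x) / (m y - m x) * F y))"
proof -
  have fin: "finite L" "finite H" and LH: "S = L \<union> H" "L \<inter> H = {}"
    using S by (auto simp: L_def H_def)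
  show D: "0 < D"
    unfolding D_def using ex w fin by (intro sum_pos2[of _ x0]) (auto simp: H_def less_imp_le)
  have DL: "(\<Sum>x\<in>L. w x * (t - m x)) = D"
    using mean unfolding LH(1) sum.union_disjoint[OF fin LH(2)] D_def
    by (simp add: algebra_simps sum_subtractf)
  have "(\<Sum>(x, y)\<in>L \<times> H. w x * w y * (m y - m x) / D *
       ((1 - (t - m x) / (m y - m x)) * F x + (t - m x) / (m y - m x) * F y))
    = (\<Sum>(x, y)\<in>L \<times> H. (w x * F x * (w y * (m y - t)) + w x * (t - m x) * (w y * F y)) / D)"
  proof (intro sum.cong refl, clarify)
    fix x y assume "x \<in> L" "y \<in> H"
    then have "m y - m x \<noteq> 0" by (auto simp: L_def H_def)
    moreover define d where "d = m y - m x"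
    ultimately have "1 - (t - m x) / d = (m y - t) / d" "d \<noteq> 0" by (auto simp: field_simps)
    then show "w x * w y * (m y - m x) / D *
        ((1 - (t - m x) / (m y - m x)) * F x + (t - m x) / (m y - m x) * F y)
      = (w x * F x * (w y * (m y - t)) + w x * (t - m x) * (w y * F y)) / D"
      using D unfolding d_def[symmetric] by (simp add: field_simps)
  qed
  also have "\<dots> = ((\<Sum>x\<in>L. w x * F x) * D + D * (\<Sum>y\<in>H. w y * F y)) / D"
    unfolding sum_divide_distrib[symmetric] sum.cartesian_product[symmetric] sum.distrib
      sum_product[symmetric] DL D_def[symmetric]
    by (simp add: split_def sum.distrib sum_product[symmetric])
  also have "\<dots> = (\<Sum>x\<in>S. w x * F x)"
    using D unfolding LH(1) sum.union_disjoint[OF fin LH(2)] by (simp add: field_simps)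
  finally show "(\<Sum>x\<in>S. w x * F x) = (\<Sum>(x, y)\<in>L \<times> H. w x * w y * (m y - m x) / D *
       ((1 - (t - m x) / (m y - m x)) * F x + (t - m x) / (m y - m x) * F y))" by simp
qed

lemma expect_symmetrize:
  assumes fin: "finite (set_pmf P)" and sym: "map_pmf prod.swap P = P"
  shows "expect P f = expect P (\<lambda>z. (f z + f (prod.swap z)) / 2)"
proof -
  have "expect P f = expect P (\<lambda>z. f (prod.swap z))"
    by (subst sym[symmetric]) simp
  moreover have "expect P (\<lambda>z. (f z + f (prod.swap z)) / 2)
      = (expect P f + expect P (\<lambda>z. f (prod.swap z))) / 2"
    using fin by (simp add: integrable_measure_pmf_finite)
  ultimately show ?thesis by simp
qed

text \<open>The bound passes from admissible laws to every symmetric law of mean \<open>t\<close>: such a law, if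
  some pair in its support has average above \<open>t\<close>, is a mixture of laws that are admissible or have mean
  entropy 0. The mean entropy and the \<open>phi1\<close> term are affine in the law, and the
  remaining term of \<open>g_fun\<close> is concave at fixed mean.\<close>

lemma g_ge_mean_entropy_at_mean:
  assumes t: "0 < t" "t < 1" and \<alpha>: "0 \<le> \<alpha>" "\<alpha> \<le> 1"
    and adm: "\<And>P. P \<in> admissible t \<Longrightarrow> c * mean_entropy P \<le> g_fun P \<alpha>"
    and fin: "finite (set_pmf P)" and P: "set_pmf P \<subseteq> {0..1} \<times> {0..1}"
    and sym: "map_pmf prod.swap P = P"
    and mean: "expect P fst = t"
    and ex: "z0 \<in> set_pmf P" "t < (fst z0 + snd z0) / 2"
  shows "c * mean_entropy P \<le> g_fun P \<alpha>"
proof -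
  define m :: "real \<times> real \<Rightarrow> real" where "m z = (fst z + snd z) / 2" for z
  define S where "S = set_pmf P"
  define L where "L = {z\<in>S. m z \<le> t}"
  define H where "H = {z\<in>S. t < m z}"
  define D where "D = (\<Sum>y\<in>H. pmf P y * (m y - t))"
  define \<beta> where "\<beta> x y = (t - m x) / (m y - m x)" for x y
  define V where "V = (\<lambda>(x, y). mixture (\<beta> x y) (Q_dist (fst x) (snd x)) (Q_dist (fst y) (snd y)))"
  \<comment> \<open>Here \<open>V (x, y)\<close> mixes the symmetrized atoms \<open>x\<close> and \<open>y\<close> to mean \<open>t\<close>, and \<open>w (x, y)\<close> is its weight.\<close>
  define w where "w = (\<lambda>(x, y). pmf P x * pmf P y * (m y - m x) / D)"
  have finS: "finite S" using fin by (simp add: S_def)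
  \<comment> \<open>By symmetry both coordinates have mean \<open>t\<close>, hence so has their average \<open>m\<close>.\<close>
  have mt: "(\<Sum>x\<in>S. pmf P x * (m x - t)) = 0"
  proof -
    have "(\<Sum>x\<in>S. pmf P x * m x) = t"
      using mean unfolding expect_symmetrize[OF fin sym, of fst] unfolding expect_finite[OF fin] S_def m_def
      by simp
    moreover have "(\<Sum>x\<in>S. pmf P x) = 1" using finS by (simp add: S_def sum_pmf_eq_1)
    ultimately show ?thesis
      by (simp add: right_diff_distrib sum_subtractf sum_distrib_right[symmetric])
  qed
  have pos: "0 < pmf P x" if "x \<in> S" for x using that by (simp add: S_def pmf_positive)
  have z0: "z0 \<in> S" "t < m z0" using ex by (auto simp: S_def m_def)
  note decomp = two_point_decomposition[OF finS mt pos z0, folded L_def H_def, folded D_def]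
  have \<beta>: "0 \<le> \<beta> x y \<and> \<beta> x y \<le> 1" if "x \<in> L" "y \<in> H" for x y
    using that by (auto simp: \<beta>_def L_def H_def divide_simps)
  have EV: "expect (V (x, y)) f = (1 - \<beta> x y) * ((f x + f (prod.swap x)) / 2)
      + \<beta> x y * ((f y + f (prod.swap y)) / 2)" if "x \<in> L" "y \<in> H" for x y f
    using \<beta>[OF that] by (simp add: V_def expect_mixture expect_Q_dist prod.swap_def)
  have dec: "expect P f = (\<Sum>k\<in>L \<times> H. w k * expect (V k) f)" for f
  proof -
    have "expect P f = (\<Sum>x\<in>S. pmf P x * ((f x + f (prod.swap x)) / 2))"
      unfolding S_def expect_finite[OF fin, symmetric] by (rule expect_symmetrize[OF fin sym])
    also have "\<dots> = (\<Sum>k\<in>L \<times> H. w k * expect (V k) f)"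
      by (subst decomp(2)) (auto intro!: sum.cong simp: EV w_def \<beta>_def)
    finally show ?thesis .
  qed
  have finV: "finite (set_pmf (V k))" for k
    by (cases k) (auto simp: V_def)
  have unit: "set_pmf (V k) \<subseteq> {0..1} \<times> {0..1}" if "k \<in> L \<times> H" for k
  proof -
    obtain x y where xy: "k = (x, y)" by (cases k)
    then have k: "k = (x, y)" "x \<in> S" "y \<in> S" using that by (auto simp: L_def H_def)
    have "set_pmf (V k) \<subseteq> {(fst x, snd x), (snd x, fst x), (fst y, snd y), (snd y, fst y)}"
      unfolding V_def k(1) using set_mixture set_Q_dist by fastforce
    then show ?thesis using k P unfolding S_def by fastforce
  qed
  have w: "0 \<le> w k" if "k \<in> L \<times> H" for k
    using that decomp(1) by (auto simp: w_def L_def H_def intro!: divide_nonneg_pos mult_nonneg_nonneg)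
  have meanV: "expect (marginal (V k)) (\<lambda>p. p) = t" if k: "k \<in> L \<times> H" for k
  proof -
    obtain x y where xy: "k = (x, y)" "x \<in> L" "y \<in> H" using k by auto
    have "m y - m x \<noteq> 0" using xy by (auto simp: L_def H_def)
    then have "\<beta> x y * (m y - m x) = t - m x" by (simp add: \<beta>_def)
    then show ?thesis
      unfolding xy(1) expect_marginal EV[OF xy(2,3)]
      by (simp add: m_def algebra_simps add_divide_distrib diff_divide_distrib)
  qed
  have gV: "c * mean_entropy (V k) \<le> g_fun (V k) \<alpha>" if k: "k \<in> L \<times> H" for k
  proof (cases "mean_entropy (V k) > 0")
    case True
    obtain x y where xy: "k = (x, y)" "x \<in> L" "y \<in> H" using k by auto
    have "x \<in> {0..1} \<times> {0..1}" "y \<in> {0..1} \<times> {0..1}"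
      using xy P by (auto simp: L_def H_def S_def)
    then have xy01: "fst x \<in> {0..1}" "snd x \<in> {0..1}" "fst y \<in> {0..1}" "snd y \<in> {0..1}"
      by (auto simp: mem_Times_iff)
    have ab: "0 \<le> m x" "m x \<le> t" "t < m y" "m y \<le> 1"
      using xy xy01 by (auto simp: m_def L_def H_def)
    have "\<beta> x y = 0 \<or> \<beta> x y > 0" using \<beta>[OF xy(2,3)] by linarith
    then have \<beta>_cases: "\<beta> x y = 0 \<or> \<beta> x y = (t - m x) / (m y - m x) \<and> \<beta> x y > 0"
      by (simp only: \<beta>_def simp_thms)
    have Vk: "V k = mixture (\<beta> x y) (Q_dist (fst x) (snd x)) (Q_dist (fst y) (snd y))"
      by (simp add: V_def xy(1))
    have "V k \<in> admissible t"
      unfolding admissible_def mem_Collect_eq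
      by (rule bexI[OF _ xy01(1)], rule bexI[OF _ xy01(2)], rule bexI[OF _ xy01(3)],
          rule bexI[OF _ xy01(4)], rule exI[of _ "m x"], rule exI[of _ "m y"], rule exI[of _ "\<beta> x y"])
        (intro conjI ab \<beta>_cases Vk True m_def)
    then show ?thesis by (rule adm)
  next
    case False
    \<comment> \<open>A pair of zero mean entropy is not admissible, but for it the bound only says \<open>g_fun \<ge> 0\<close>.\<close>
    have "0 \<le> mean_entropy (V k)"
      unfolding mean_entropy_eq using unit[OF k]
      by (intro expect_nonneg binary_entropy_nonneg) auto
    then have "mean_entropy (V k) = 0" using False by simp
    then show ?thesis using g_fun_nonneg[OF unit[OF k] \<alpha>] by simp
  qed
  have prod: "(\<Sum>k\<in>L \<times> H. w k * product_entropy (marginal (V k))) \<le> product_entropy (marginal P)"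
  proof (rule product_entropy_concave)
    show "finite (L \<times> H)" using finS by (auto simp: L_def H_def)
    show "0 \<le> w k" if "k \<in> L \<times> H" for k by (rule w[OF that])
    show "finite (set_pmf (marginal (V k))) \<and> set_pmf (marginal (V k)) \<subseteq> {0..1}" if "k \<in> L \<times> H" for k
      using marginal_unit_interval[OF unit[OF that]] finV by (simp add: marginal_def)
    show "expect (marginal (V k)) (\<lambda>p. p) = t" if "k \<in> L \<times> H" for k by (rule meanV[OF that])
    show "finite (set_pmf (marginal P))" using fin by (simp add: marginal_def)
    show "set_pmf (marginal P) \<subseteq> {0..1}" by (rule marginal_unit_interval[OF P])
    show "expect (marginal P) f = (\<Sum>k\<in>L \<times> H. w k * expect (marginal (V k)) f)" for f
      unfolding expect_marginal by (rule dec)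
  qed
  have "c * mean_entropy P = (\<Sum>k\<in>L \<times> H. w k * (c * mean_entropy (V k)))"
    unfolding mean_entropy_eq dec[of "\<lambda>z. binary_entropy (fst z)"] by (simp add: sum_distrib_left mult_ac)
  also have "\<dots> \<le> (\<Sum>k\<in>L \<times> H. w k * g_fun (V k) \<alpha>)"
    by (intro sum_mono mult_left_mono gV w)
  also have "\<dots> = (1 - \<alpha>) * (\<Sum>k\<in>L \<times> H. w k * product_entropy (marginal (V k)))
      + \<alpha> * expect P (\<lambda>(p, q). binary_entropy (phi1 p q))"
    unfolding g_fun_eq dec[of "\<lambda>(p, q). binary_entropy (phi1 p q)"] distrib_left sum.distrib
    by (simp add: sum_distrib_left mult_ac)
  also have "\<dots> \<le> g_fun P \<alpha>"
    unfolding g_fun_eq using \<alpha> prod by (intro add_right_mono mult_left_mono) auto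
  finally show ?thesis .
qed

text \<open>A mean below \<open>t\<close> is raised to \<open>t\<close> by an extra atom of mass \<open>l\<close> at \<open>(1, 1)\<close>. All entropies
  involving a coordinate 1 vanish, so the mean entropy and the \<open>phi1\<close> term shrink by the factor
  \<open>1 - l\<close>, while the product term, which involves two draws, shrinks by \<open>(1 - l)^2\<close>. The bound for
  the enlarged law is therefore the stronger one. The atom also supplies the point above \<open>t\<close> that the
  decomposition requires.\<close>

lemma g_ge_mean_entropy:
  assumes t: "0 < t" "t < 1" and \<alpha>: "0 \<le> \<alpha>" "\<alpha> \<le> 1"
    and adm: "\<And>P. P \<in> admissible t \<Longrightarrow> c * mean_entropy P \<le> g_fun P \<alpha>"
    and fin: "finite (set_pmf P)" and P: "set_pmf P \<subseteq> {0..1} \<times> {0..1}"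
    and sym: "map_pmf prod.swap P = P"
    and mean: "expect P fst < t"
  shows "c * mean_entropy P \<le> g_fun P \<alpha>"
proof -
  define m where "m = expect P fst"
  \<comment> \<open>The mass at \<open>(1, 1)\<close> that makes \<open>(1 - l) * m + l\<close> equal to \<open>t\<close>.\<close>
  define l where "l = (t - m) / (1 - m)"
  have l: "0 < l" "l < 1" using mean t unfolding l_def m_def by (auto simp: divide_simps)
  define R where "R = mixture l P (return_pmf (1, 1))"
  have finR: "finite (set_pmf R)" unfolding R_def using fin by auto
  have ER: "expect R f = (1 - l) * expect P f + l * f (1, 1)" for f
    unfolding R_def using l fin by (subst expect_mixture) auto
  have finm: "finite (set_pmf (marginal Q))" if "finite (set_pmf Q)" for Q
    using that by (simp add: marginal_def)
  have "product_entropy (marginal R) = (1 - l) * ((1 - l) * product_entropy (marginal P))"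
    unfolding product_entropy_def expect_pair[OF finm[OF finR] finm[OF finR]]
      expect_pair[OF finm[OF fin] finm[OF fin]]
    by (simp add: expect_marginal ER)
  moreover have "phi1 1 1 = 1" by (simp add: phi1_def median3_def)
  ultimately have gR: "g_fun R \<alpha> = (1 - l) * ((1 - \<alpha>) * ((1 - l) * product_entropy (marginal P))
      + \<alpha> * expect P (\<lambda>(p, q). binary_entropy (phi1 p q)))"
    unfolding g_fun_eq ER by (simp add: distrib_left mult.left_commute)
  have "c * mean_entropy R \<le> g_fun R \<alpha>"
  proof (rule g_ge_mean_entropy_at_mean[OF t \<alpha> adm finR])
    show "set_pmf R \<subseteq> {0..1} \<times> {0..1}"
      unfolding R_def using set_mixture[of l P "return_pmf (1, 1)"] P by auto
    show "map_pmf prod.swap R = R" unfolding R_def map_mixture sym by simp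
    have "1 - m \<noteq> 0" using mean t by (simp add: m_def)
    then have "l * (1 - m) = t - m" by (simp add: l_def)
    then show "expect R fst = t" unfolding ER m_def[symmetric] by (simp add: algebra_simps)
    show "(1, 1) \<in> set_pmf R"
      unfolding R_def mixture_def using l by (auto)
    show "t < (fst (1, 1) + snd (1, 1)) / 2" using t by simp
  qed
  then have "(1 - l) * (c * mean_entropy P) \<le> g_fun R \<alpha>"
    unfolding mean_entropy_eq ER by (simp add: algebra_simps)
  then have "c * mean_entropy P \<le> (1 - \<alpha>) * ((1 - l) * product_entropy (marginal P))
      + \<alpha> * expect P (\<lambda>(p, q). binary_entropy (phi1 p q))"
    unfolding gR using l by simp
  also have "\<dots> \<le> g_fun P \<alpha>"
    unfolding g_fun_eq using \<alpha> l product_entropy_nonneg[OF marginal_unit_interval[OF P]]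
    by (intro add_right_mono mult_left_mono mult_left_le_one_le) auto
  finally show ?thesis .
qed

text \<open>One weight \<open>\<alpha>\<close> and one factor \<open>c > 1\<close> serve all admissible laws, so that the bounds for different
  laws can be added. The product form also makes sense when the mean entropy is 0.\<close>

lemma Gamma_hat_witness:
  assumes "Gamma_hat t > 1"
  obtains \<alpha> c where "0 \<le> \<alpha>" "\<alpha> \<le> 1" "1 < c"
    "\<And>P. P \<in> admissible t \<Longrightarrow> c * mean_entropy P \<le> g_fun P \<alpha>"
proof -
  obtain \<alpha> where \<alpha>: "\<alpha> \<in> {0..1}"
    and inf: "1 < (INF P\<in>admissible t. ereal (g_fun P \<alpha> / mean_entropy P))"
    using assms unfolding Gamma_hat_def less_SUP_iff by blast
  obtain c where c: "1 < ereal c" "ereal c < (INF P\<in>admissible t. ereal (g_fun P \<alpha> / mean_entropy P))"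
    using ereal_dense2[OF inf] by blast
  have "c * mean_entropy P \<le> g_fun P \<alpha>" if "P \<in> admissible t" for P
  proof -
    have "ereal c < ereal (g_fun P \<alpha> / mean_entropy P)"
      using c(2) INF_lower[OF that, of "\<lambda>P. ereal (g_fun P \<alpha> / mean_entropy P)"] by (rule less_le_trans)
    moreover have "mean_entropy P > 0" using that by (auto simp: admissible_def)
    ultimately show ?thesis by (simp add: field_simps)
  qed
  with \<alpha> c(1) show ?thesis by (intro that[of \<alpha> c]) (auto simp: one_ereal_def)
qed

section \<open>Coupling two bits with a prescribed OR\<close>

text \<open>The joint law of two bits with biases \<open>p\<close> and \<open>q\<close> whose OR has bias \<open>s\<close>: these three numbers
  determine all four probabilities.\<close>

definition or_coupling :: "real \<Rightarrow> real \<Rightarrow> real \<Rightarrow> (bool \<times> bool) pmf" where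
  "or_coupling p q s = embed_pmf (\<lambda>(b, c).
     if b then (if c then p + q - s else s - q) else (if c then s - p else 1 - s))"

lemma sum_UNIV_bool_prod: "(\<Sum>z\<in>(UNIV :: (bool \<times> bool) set). f z)
    = f (True, True) + f (True, False) + f (False, True) + f (False, False)"
  for f :: "bool \<times> bool \<Rightarrow> 'a :: comm_monoid_add"
proof -
  have UNIV_eq: "(UNIV :: (bool \<times> bool) set) = {(True, True), (True, False), (False, True), (False, False)}"
    by auto
  show ?thesis unfolding UNIV_eq by (simp add: add.assoc)
qed

lemma pmf_or_coupling:
  assumes "max p q \<le> s" "s \<le> min 1 (p + q)"
  shows "pmf (or_coupling p q s) (b, c) =
    (if b then (if c then p + q - s else s - q) else (if c then s - p else 1 - s))"
  unfolding or_coupling_def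
proof (subst pmf_embed_pmf)
  show "(\<integral>\<^sup>+x. ennreal (case x of (b, c) \<Rightarrow> if b then (if c then p + q - s else s - q)
      else (if c then s - p else 1 - s)) \<partial>count_space UNIV) = 1"
    using assms
    by (subst nn_integral_count_space_finite)
      (simp_all add: sum_UNIV_bool_prod ennreal_plus[symmetric] del: ennreal_plus)
qed (use assms in auto)

lemma expect_or_coupling:
  assumes "max p q \<le> s" "s \<le> min 1 (p + q)"
  shows "expect (or_coupling p q s) f = (p + q - s) * f (True, True) + (s - q) * f (True, False)
     + (s - p) * f (False, True) + (1 - s) * f (False, False)"
  by (subst integral_measure_pmf[of UNIV])
    (simp_all add: sum_UNIV_bool_prod pmf_or_coupling[OF assms])

lemma bool_pmf_eqI:
  fixes M N :: "bool pmf"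
  assumes "pmf M True = pmf N True"
  shows "M = N"
proof (rule pmf_eqI)
  have "pmf K True + pmf K False = 1" for K :: "bool pmf"
  proof -
    have "sum (pmf K) UNIV = 1" by (rule sum_pmf_eq_1) auto
    then show ?thesis by (simp add: UNIV_bool add.commute)
  qed
  from this[of M] this[of N] show "pmf M b = pmf N b" for b
    using assms by (cases b) auto
qed

lemma pmf_map_expect: "pmf (map_pmf f M) y = expect M (\<lambda>x. of_bool (f x = y))"
proof -
  have "pmf (map_pmf f M) y = expect M (indicator (f -` {y}))"
    by (simp add: pmf_map)
  also have "\<dots> = expect M (\<lambda>x. of_bool (f x = y))"
    by (rule expect_cong) (simp add: indicator_def)
  finally show ?thesis .
qed

lemma map_or_coupling:
  assumes "max p q \<le> s" "s \<le> min 1 (p + q)"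
  shows "map_pmf fst (or_coupling p q s) = bernoulli_pmf p"
    and "map_pmf snd (or_coupling p q s) = bernoulli_pmf q"
    and "map_pmf (\<lambda>(b, c). b \<or> c) (or_coupling p q s) = bernoulli_pmf s"
    and "map_pmf prod.swap (or_coupling p q s) = or_coupling q p s"
proof -
  have pqs: "0 \<le> p" "p \<le> 1" "0 \<le> q" "q \<le> 1" "0 \<le> s" "s \<le> 1"
    using assms by (auto simp: max_def split: if_splits)
  show "map_pmf fst (or_coupling p q s) = bernoulli_pmf p"
    "map_pmf snd (or_coupling p q s) = bernoulli_pmf q"
    "map_pmf (\<lambda>(b, c). b \<or> c) (or_coupling p q s) = bernoulli_pmf s"
    using pqs by (auto intro!: bool_pmf_eqI simp: pmf_map_expect expect_or_coupling[OF assms])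
  have assms': "max q p \<le> s" "s \<le> min 1 (q + p)" using assms by auto
  show "map_pmf prod.swap (or_coupling p q s) = or_coupling q p s"
  proof (rule pmf_eqI)
    fix z :: "bool \<times> bool"
    obtain b c where z: "z = (b, c)" by (cases z)
    have "pmf (map_pmf prod.swap (or_coupling p q s)) (prod.swap (c, b)) = pmf (or_coupling p q s) (c, b)"
      by (rule pmf_map_inj') simp
    then show "pmf (map_pmf prod.swap (or_coupling p q s)) z = pmf (or_coupling q p s) z"
      unfolding z by (simp add: pmf_or_coupling[OF assms] pmf_or_coupling[OF assms'])
  qed
qed

lemma or_coupling_independent:
  assumes "0 \<le> p" "p \<le> 1" "0 \<le> q" "q \<le> 1"
  shows "or_coupling p q (p + q - p * q) = pair_pmf (bernoulli_pmf p) (bernoulli_pmf q)"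
proof (rule pmf_eqI)
  fix z :: "bool \<times> bool"
  obtain b c where z: "z = (b, c)" by (cases z)
  show "pmf (or_coupling p q (p + q - p * q)) z = pmf (pair_pmf (bernoulli_pmf p) (bernoulli_pmf q)) z"
    unfolding z pmf_pair pmf_or_coupling[OF or_prob_bounds[OF assms]]
    using assms by (cases b; cases c) (auto simp: algebra_simps)
qed

section \<open>A uniform element of an OR-closed family\<close>

text \<open>Prefixes are lists in reading order, so that revealing one more coordinate appends a bit.\<close>

definition prefix_bits :: "nat \<Rightarrow> (nat \<Rightarrow> bool) \<Rightarrow> bool list" where
  "prefix_bits k x = map x [1..<Suc k]"

lemma prefix_bits_0 [simp]: "prefix_bits 0 x = []"
  and prefix_bits_Suc: "prefix_bits (Suc k) x = prefix_bits k x @ [x (Suc k)]"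
  and length_prefix_bits [simp]: "length (prefix_bits k x) = k"
  by (simp_all add: prefix_bits_def)

lemma inj_on_prefix_bits: "inj_on (prefix_bits n) (cube n)"
proof (rule inj_onI)
  fix x y assume xy: "x \<in> cube n" "y \<in> cube n" "prefix_bits n x = prefix_bits n y"
  have "x i = y i" if "i \<in> {1..n}" for i
    using xy(3) that unfolding prefix_bits_def map_eq_conv set_upt by simp
  then show "x = y" using xy(1,2) unfolding cube_def by (intro PiE_ext) auto
qed

lemma finite_cube: "finite (cube n)"
  unfolding cube_def by (intro finite_PiE) auto

definition or_list :: "bool list \<Rightarrow> bool list \<Rightarrow> bool list" where
  "or_list = map2 (\<or>)"

lemma or_list_append [simp]:
  "length s = length s' \<Longrightarrow> or_list (s @ [b]) (s' @ [b']) = or_list s s' @ [b \<or> b']"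
  by (simp add: or_list_def)

lemma prefix_bits_or_vec:
  assumes "k \<le> n"
  shows "prefix_bits k (or_vec n x y) = or_list (prefix_bits k x) (prefix_bits k y)"
  using assms
proof (induction k)
  case (Suc k)
  then show ?case by (simp add: prefix_bits_Suc or_vec_def)
qed (simp add: or_list_def)

locale or_family =
  fixes n :: nat and A :: "(nat \<Rightarrow> bool) set"
  assumes A_cube: "A \<subseteq> cube n" and A_ne: "A \<noteq> {}" and A_closed: "or_closed n A"
begin

lemma finite_A: "finite A"
  using A_cube finite_cube finite_subset by blast

definition completions :: "bool list \<Rightarrow> nat" where
  "completions s = card {x \<in> A. prefix_bits (length s) x = s}"

text \<open>The conditional probability that the next coordinate is 1, for a uniform element of \<open>A\<close> with
  prefix \<open>s\<close>. A prefix that does not occur in \<open>A\<close> gets the value 0, so all values lie in the unit interval.\<close>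

definition next_prob :: "bool list \<Rightarrow> real" where
  "next_prob s = real (completions (s @ [True])) / real (completions s)"

definition prefix_law :: "nat \<Rightarrow> bool list pmf" where
  "prefix_law k = map_pmf (prefix_bits k) (pmf_of_set A)"

lemma completions_split: "completions s = completions (s @ [True]) + completions (s @ [False])"
proof -
  have "{x \<in> A. prefix_bits (length s) x = s} =
      {x \<in> A. prefix_bits (length (s @ [True])) x = s @ [True]} \<union> {x \<in> A. prefix_bits (length (s @ [False])) x = s @ [False]}"
    by (auto simp: prefix_bits_Suc)
  then show ?thesis unfolding completions_def
    using finite_A by (simp only:) (subst card_Un_disjoint, auto)
qed

lemma next_prob_bounds: "0 \<le> next_prob s" "next_prob s \<le> 1"
  using completions_split[of s] by (auto simp: next_prob_def divide_simps)

lemma completions_pos_iff: "0 < completions s \<longleftrightarrow> (\<exists>x\<in>A. prefix_bits (length s) x = s)"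
  using finite_A by (auto simp: completions_def card_gt_0_iff)

lemma one_minus_next_prob: "0 < completions s \<Longrightarrow> 1 - next_prob s = real (completions (s @ [False])) / real (completions s)"
proof -
  assume "0 < completions s"
  moreover have "real (completions (s @ [False])) = real (completions s) - real (completions (s @ [True]))"
    using completions_split[of s] by simp
  ultimately show ?thesis by (simp add: next_prob_def diff_divide_distrib)
qed

lemma completions_0: "completions [] = card A"
  by (simp add: completions_def)

lemma completions_full: "length s = n \<Longrightarrow> completions s \<le> 1"
  unfolding completions_def
proof (rule ccontr)
  assume "length s = n" "\<not> card {x \<in> A. prefix_bits (length s) x = s} \<le> 1"
  then obtain x y where "x \<in> A" "y \<in> A" "prefix_bits n x = s" "prefix_bits n y = s" "x \<noteq> y"
    using finite_A by (auto simp: card_le_Suc0_iff_eq)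
  then show False using inj_on_prefix_bits A_cube by (metis inj_onD subsetD)
qed

lemma prefix_law_0: "prefix_law 0 = return_pmf []"
proof -
  have "prefix_bits 0 = (\<lambda>_. [])" by (rule ext) simp
  then show ?thesis by (simp add: prefix_law_def)
qed

lemma set_prefix_law: "set_pmf (prefix_law k) = prefix_bits k ` A"
  using finite_A A_ne by (simp add: prefix_law_def)

lemma finite_prefix_law: "finite (set_pmf (prefix_law k))"
  using finite_A by (simp add: set_prefix_law)

lemma prefix_law_completions_pos: "s \<in> set_pmf (prefix_law k) \<Longrightarrow> 0 < completions s"
  by (auto simp: set_prefix_law completions_pos_iff)

lemma pmf_prefix_law: "pmf (prefix_law k) s = (if length s = k then real (completions s) / real (card A) else 0)"
proof -
  have "pmf (prefix_law k) s = real (card (A \<inter> prefix_bits k -` {s})) / real (card A)"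
    using finite_A A_ne by (simp add: prefix_law_def pmf_map measure_pmf_of_set)
  also have "A \<inter> prefix_bits k -` {s} = (if length s = k then {x \<in> A. prefix_bits (length s) x = s} else {})"
    by auto
  finally show ?thesis by (simp add: completions_def)
qed

text \<open>The uniform law on \<open>A\<close> revealed one coordinate at a time. This recursive form is what the
  coupled process below is compared with.\<close>

lemma prefix_law_Suc:
  "prefix_law (Suc k) = prefix_law k \<bind> (\<lambda>s. map_pmf (\<lambda>b. s @ [b]) (bernoulli_pmf (next_prob s)))"
proof (rule pmf_eqI)
  fix l :: "bool list"
  show "pmf (prefix_law (Suc k)) l = pmf (prefix_law k \<bind> (\<lambda>s. map_pmf (\<lambda>b. s @ [b]) (bernoulli_pmf (next_prob s)))) l"
  proof (cases l rule: rev_cases)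
    case Nil
    have "pmf (map_pmf (\<lambda>b. s @ [b]) (bernoulli_pmf (next_prob s))) [] = 0" for s
      by (auto simp: pmf_eq_0_set_pmf)
    then show ?thesis by (simp add: Nil pmf_prefix_law pmf_bind)
  next
    case (snoc s b)
    have inj: "inj (\<lambda>b. s' @ [b])" for s' :: "bool list" by (auto intro: injI)
    have "pmf (map_pmf (\<lambda>b. s' @ [b]) (bernoulli_pmf (next_prob s'))) (s @ [b])
        = of_bool (s' = s) * pmf (bernoulli_pmf (next_prob s)) b" for s'
    proof (cases "s' = s")
      case True
      then show ?thesis using pmf_map_inj'[OF inj, of s "bernoulli_pmf (next_prob s)" b] by simp
    qed (auto simp: pmf_eq_0_set_pmf)
    then have "pmf (prefix_law k \<bind> (\<lambda>s. map_pmf (\<lambda>b. s @ [b]) (bernoulli_pmf (next_prob s)))) l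
        = expect (prefix_law k) (\<lambda>s'. of_bool (s' = s) * pmf (bernoulli_pmf (next_prob s)) b)"
      by (simp add: snoc pmf_bind)
    also have "\<dots> = pmf (prefix_law k) s * pmf (bernoulli_pmf (next_prob s)) b"
      by (subst integral_measure_pmf[of "{s}"]) auto
    also have "\<dots> = pmf (prefix_law (Suc k)) l"
    proof (cases "completions s = 0")
      case True
      then have "completions (s @ [b]) = 0" using completions_split[of s] by (cases b) auto
      then show ?thesis using True by (simp add: snoc pmf_prefix_law)
    next
      case False
      then show ?thesis using next_prob_bounds[of s] one_minus_next_prob[of s]
        by (cases b) (auto simp: snoc pmf_prefix_law, simp_all add: next_prob_def)
    qed
    finally show ?thesis by simp
  qed
qed

lemma expect_next_prob: "expect (prefix_law k) next_prob = measure_pmf.prob (pmf_of_set A) {x. x (Suc k)}"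
proof -
  have "map_pmf last (prefix_law (Suc k)) = map_pmf (\<lambda>x. x (Suc k)) (pmf_of_set A)"
    by (simp add: prefix_law_def map_pmf_comp prefix_bits_Suc)
  moreover have "map_pmf last (prefix_law (Suc k)) = prefix_law k \<bind> (\<lambda>s. bernoulli_pmf (next_prob s))"
    unfolding prefix_law_Suc by (simp add: map_bind_pmf map_pmf_comp)
  ultimately have "pmf (prefix_law k \<bind> (\<lambda>s. bernoulli_pmf (next_prob s))) True
      = pmf (map_pmf (\<lambda>x. x (Suc k)) (pmf_of_set A)) True" by simp
  then show ?thesis
    by (simp add: pmf_bind next_prob_bounds pmf_map vimage_def)
qed

text \<open>On average, one revealed coordinate lowers the logarithm of the number of completions by exactly
  the entropy of that coordinate.\<close>

lemma entropy_telescope: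
  "expect (prefix_law k) (\<lambda>s. binary_entropy (next_prob s))
     = expect (prefix_law k) (\<lambda>s. log 2 (completions s)) - expect (prefix_law (Suc k)) (\<lambda>s. log 2 (completions s))"
proof -
  have "expect (prefix_law (Suc k)) (\<lambda>s. log 2 (completions s))
      = expect (prefix_law k) (\<lambda>s. next_prob s * log 2 (completions (s @ [True])) + (1 - next_prob s) * log 2 (completions (s @ [False])))"
    unfolding prefix_law_Suc using finite_prefix_law by (subst expect_bind) (auto simp: next_prob_bounds mult.commute)
  also have "\<dots> = expect (prefix_law k) (\<lambda>s. log 2 (completions s) - binary_entropy (next_prob s))"
  proof (rule expect_cong)
    fix s assume "s \<in> set_pmf (prefix_law k)"
    then have pos: "0 < completions s" by (rule prefix_law_completions_pos)
    have chain: "r * log 2 (real m) = r * log 2 (completions s) + r * log 2 r" if "r = real m / completions s" for r m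
      using that pos by (cases "m = 0") (auto simp: log_divide algebra_simps)
    show "next_prob s * log 2 (completions (s @ [True])) + (1 - next_prob s) * log 2 (completions (s @ [False]))
        = log 2 (completions s) - binary_entropy (next_prob s)"
      using chain[OF next_prob_def] chain[OF one_minus_next_prob[OF pos]]
      by (simp add: binary_entropy_def algebra_simps)
  qed
  also have "\<dots> = expect (prefix_law k) (\<lambda>s. log 2 (completions s)) - expect (prefix_law k) (\<lambda>s. binary_entropy (next_prob s))"
    using finite_prefix_law by (intro Bochner_Integration.integral_diff integrable_measure_pmf_finite)
  finally show ?thesis by simp
qed

text \<open>The telescoping sum starts at \<open>log 2 (card A)\<close>, for the empty prefix, and ends at 0, since a full
  prefix has a single completion.\<close>

lemma entropy_chain_rule:
  "(\<Sum>k<n. expect (prefix_law k) (\<lambda>s. binary_entropy (next_prob s))) = log 2 (card A)"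
proof -
  have "expect (prefix_law n) (\<lambda>s. log 2 (completions s)) = expect (prefix_law n) (\<lambda>_. 0)"
  proof (rule expect_cong)
    fix s assume s: "s \<in> set_pmf (prefix_law n)"
    then have "length s = n" by (auto simp: set_prefix_law)
    then have "completions s = 1" using completions_full[of s] prefix_law_completions_pos[OF s] by simp
    then show "log 2 (completions s) = 0" by simp
  qed
  then show ?thesis
    using sum_lessThan_telescope'[of "\<lambda>k. expect (prefix_law k) (\<lambda>s. log 2 (completions s))" n]
    by (simp add: entropy_telescope completions_0 prefix_law_0)
qed

end

section \<open>Coupled pairs and the entropy of their OR\<close>

text \<open>Two elements of \<open>A\<close> are revealed in parallel. Given both prefixes, the next two bits are coupled
  so that their OR is 1 with probability \<open>\<psi> p q\<close>, where \<open>p\<close> and \<open>q\<close> are the conditional probabilities of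
  a 1. The bounds say that such a coupling exists.\<close>

locale or_family_coupling = or_family +
  fixes \<psi> :: "real \<Rightarrow> real \<Rightarrow> real"
  assumes \<psi>_bounds: "\<And>p q. 0 \<le> p \<Longrightarrow> p \<le> 1 \<Longrightarrow> 0 \<le> q \<Longrightarrow> q \<le> 1 \<Longrightarrow>
      max p q \<le> \<psi> p q \<and> \<psi> p q \<le> min 1 (p + q)"
    and \<psi>_commute: "\<And>p q. \<psi> p q = \<psi> q p"
begin

definition kernel :: "bool list \<Rightarrow> bool list \<Rightarrow> (bool \<times> bool) pmf" where
  "kernel s s' = or_coupling (next_prob s) (next_prob s') (\<psi> (next_prob s) (next_prob s'))"

primrec pair_law :: "nat \<Rightarrow> (bool list \<times> bool list) pmf" where
  "pair_law 0 = return_pmf ([], [])"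
| "pair_law (Suc k) = pair_law k \<bind>
     (\<lambda>(s, s'). map_pmf (\<lambda>(b, b'). (s @ [b], s' @ [b'])) (kernel s s'))"

lemma \<psi>_next_prob: "max (next_prob s) (next_prob s') \<le> \<psi> (next_prob s) (next_prob s')"
    "\<psi> (next_prob s) (next_prob s') \<le> min 1 (next_prob s + next_prob s')"
  using \<psi>_bounds next_prob_bounds by auto

lemmas map_kernel = map_or_coupling[OF \<psi>_next_prob, folded kernel_def]

lemma pair_law_swap: "map_pmf prod.swap (pair_law k) = pair_law k"
proof (induction k)
  case (Suc k)
  have "map_pmf prod.swap (pair_law (Suc k))
    = pair_law k \<bind> (\<lambda>(s, s'). map_pmf (\<lambda>(b, b'). (s' @ [b], s @ [b'])) (map_pmf prod.swap (kernel s s')))"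
    by (auto simp: map_bind_pmf map_pmf_comp split_def prod.swap_def intro!: bind_pmf_cong)
  also have "\<dots> = map_pmf prod.swap (pair_law k) \<bind>
      (\<lambda>(s, s'). map_pmf (\<lambda>(b, b'). (s @ [b], s' @ [b'])) (kernel s s'))"
    unfolding bind_map_pmf map_kernel(4) by (simp add: split_def kernel_def \<psi>_commute)
  also have "\<dots> = pair_law (Suc k)" unfolding Suc by simp
  finally show ?case .
qed simp

text \<open>Each bit depends on the other sequence only through the coupling, so each sequence alone is
  distributed like a uniform element of \<open>A\<close>.\<close>

lemma map_fst_pair_law: "map_pmf fst (pair_law k) = prefix_law k"
proof (induction k)
  case (Suc k)
  have "map_pmf fst (pair_law (Suc k))
    = pair_law k \<bind> (\<lambda>(s, s'). map_pmf (\<lambda>b. s @ [b]) (map_pmf fst (kernel s s')))"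
    by (auto simp: map_bind_pmf map_pmf_comp split_def intro!: bind_pmf_cong)
  also have "\<dots> = map_pmf fst (pair_law k) \<bind> (\<lambda>s. map_pmf (\<lambda>b. s @ [b]) (bernoulli_pmf (next_prob s)))"
    unfolding bind_map_pmf map_kernel(1) by (simp add: split_def)
  also have "\<dots> = prefix_law (Suc k)" unfolding Suc prefix_law_Suc ..
  finally show ?case .
qed (simp add: prefix_law_0)

lemma map_snd_pair_law: "map_pmf snd (pair_law k) = prefix_law k"
proof -
  have "map_pmf snd (pair_law k) = map_pmf fst (map_pmf prod.swap (pair_law k))"
    by (simp add: map_pmf_comp)
  then show ?thesis by (simp add: pair_law_swap map_fst_pair_law)
qed

lemma set_pair_law: "set_pmf (pair_law k) \<subseteq> prefix_bits k ` A \<times> prefix_bits k ` A"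
proof -
  have "fst ` set_pmf (pair_law k) = prefix_bits k ` A" "snd ` set_pmf (pair_law k) = prefix_bits k ` A"
    by (metis set_map_pmf map_fst_pair_law set_prefix_law, metis set_map_pmf map_snd_pair_law set_prefix_law)
  then show ?thesis by force
qed

lemma finite_pair_law: "finite (set_pmf (pair_law k))"
  using finite_subset[OF set_pair_law] finite_A by blast

text \<open>This is where OR-closedness enters: the OR of two prefixes of elements of \<open>A\<close> is again a prefix
  of an element of \<open>A\<close>.\<close>

lemma completions_or_pos:
  assumes "(s, s') \<in> set_pmf (pair_law k)" "k \<le> n"
  shows "0 < completions (or_list s s')"
proof -
  obtain x y where xy: "x \<in> A" "y \<in> A" "s = prefix_bits k x" "s' = prefix_bits k y"
    using set_pair_law assms(1) by blast
  have "prefix_bits k (or_vec n x y) = or_list s s'" using prefix_bits_or_vec[OF assms(2)] xy by simp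
  moreover have "or_vec n x y \<in> A" using A_closed xy by (auto simp: or_closed_def)
  moreover have "length (or_list s s') = k" using xy by (simp add: or_list_def)
  ultimately show ?thesis unfolding completions_pos_iff by metis
qed

text \<open>The OR of the two prefixes always has completions in \<open>A\<close>. Given the history, its next bit has bias
  \<open>\<psi> p q\<close>, whereas for a uniform element of \<open>A\<close> it would have the bias \<open>next_prob z\<close>. The mean drop
  of the logarithm of the number of completions is the cross entropy of these two laws, and Gibbs'
  inequality bounds it below by the entropy of the actual bit.\<close>

lemma or_entropy_step:
  assumes k: "k < n"
  shows "expect (pair_law k) (\<lambda>(s, s'). binary_entropy (\<psi> (next_prob s) (next_prob s')))
     \<le> expect (pair_law k) (\<lambda>(s, s'). log 2 (completions (or_list s s')))
      - expect (pair_law (Suc k)) (\<lambda>(s, s'). log 2 (completions (or_list s s')))"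
proof -
  let ?G = "\<lambda>(s, s'). log 2 (real (completions (or_list s s')))"
  let ?h = "\<lambda>(s, s'). binary_entropy (\<psi> (next_prob s) (next_prob s'))"
  have "expect (pair_law (Suc k)) ?G = expect (pair_law k)
     (\<lambda>(s, s'). expect (kernel s s') (\<lambda>(b, b'). log 2 (completions (or_list (s @ [b]) (s' @ [b'])))))"
    using finite_pair_law by (simp, subst expect_bind) (auto simp: split_def)
  also have "\<dots> \<le> expect (pair_law k) (\<lambda>z. ?G z - ?h z)"
  proof (rule expect_mono[OF finite_pair_law], clarify)
    fix s s' assume ss: "(s, s') \<in> set_pmf (pair_law k)"
    define z where "z = or_list s s'"
    define r where "r = \<psi> (next_prob s) (next_prob s')"
    have len: "length s = length s'" using ss set_pair_law by fastforce
    have r: "0 \<le> r" "r \<le> 1" using \<psi>_next_prob[of s s'] next_prob_bounds unfolding r_def by (auto simp: le_max_iff_disj max_def split: if_splits intro: order_trans)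
    have or_kernel: "map_pmf (\<lambda>(b, b'). b \<or> b') (kernel s s') = bernoulli_pmf r"
      unfolding r_def by (rule map_kernel(3))
    have pos: "0 < completions z" unfolding z_def using completions_or_pos[OF ss] k by simp
    \<comment> \<open>A bit of positive probability extends \<open>z\<close> within \<open>A\<close>, so the cross entropy is finite.\<close>
    have pos_ext: "0 < completions (z @ [d])" if d: "d \<in> set_pmf (bernoulli_pmf r)" for d
    proof -
      obtain b b' where b: "(b, b') \<in> set_pmf (kernel s s')" "d = (b \<or> b')"
        using d unfolding or_kernel[symmetric] by auto
      then have "(s @ [b], s' @ [b']) \<in> set_pmf (pair_law (Suc k))"
        using ss by (auto intro!: bexI[of _ "(s, s')"])
      from completions_or_pos[OF this] k show ?thesis using len b(2) by (simp add: z_def)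
    qed
    have T: "0 < completions (z @ [True])" if "0 < r"
      using that r by (intro pos_ext) (auto simp: set_pmf_iff)
    have F: "0 < completions (z @ [False])" if "r < 1"
      using that r by (intro pos_ext) (auto simp: set_pmf_iff)
    have "expect (kernel s s') (\<lambda>(b, b'). log 2 (completions (or_list (s @ [b]) (s' @ [b']))))
       = expect (map_pmf (\<lambda>(b, b'). b \<or> b') (kernel s s')) (\<lambda>d. log 2 (completions (z @ [d])))"
      using len by (simp add: z_def split_def)
    also have "\<dots> = r * log 2 (completions (z @ [True])) + (1 - r) * log 2 (completions (z @ [False]))"
      unfolding or_kernel using r by (simp add: mult.commute)
    also have "\<dots> = log 2 (completions z) + r * log 2 (next_prob z) + (1 - r) * log 2 (1 - next_prob z)"
    proof -
      have "r * log 2 (completions (z @ [True])) = r * log 2 (completions z) + r * log 2 (next_prob z)"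
        using T pos r by (cases "r = 0") (auto simp: next_prob_def log_divide algebra_simps)
      moreover have "(1 - r) * log 2 (completions (z @ [False])) = (1 - r) * log 2 (completions z) + (1 - r) * log 2 (1 - next_prob z)"
        using F pos r unfolding one_minus_next_prob[OF pos] by (cases "r = 1") (auto simp: log_divide algebra_simps)
      ultimately show ?thesis by (simp add: algebra_simps)
    qed
    also have "\<dots> \<le> log 2 (completions z) - binary_entropy r"
    proof -
      have "0 < next_prob z" if "0 < r" using T[OF that] pos by (simp add: next_prob_def)
      moreover have "0 < 1 - next_prob z" if "r < 1"
        using F[OF that] pos unfolding one_minus_next_prob[OF pos] by simp
      ultimately have "binary_entropy r \<le> - r * log 2 (next_prob z) - (1 - r) * log 2 (1 - next_prob z)"
        using r next_prob_bounds by (intro binary_entropy_le_cross_entropy) auto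
      then show ?thesis by simp
    qed
    finally show "expect (kernel s s') (\<lambda>(b, b'). log 2 (completions (or_list (s @ [b]) (s' @ [b']))))
       \<le> log 2 (completions (or_list s s')) - binary_entropy (\<psi> (next_prob s) (next_prob s'))"
      unfolding z_def r_def .
  qed
  also have "\<dots> = expect (pair_law k) ?G - expect (pair_law k) ?h"
    using finite_pair_law by (intro Bochner_Integration.integral_diff integrable_measure_pmf_finite)
  finally show ?thesis by simp
qed

lemma or_entropy_sum_le:
  "(\<Sum>k<n. expect (pair_law k) (\<lambda>(s, s'). binary_entropy (\<psi> (next_prob s) (next_prob s')))) \<le> log 2 (card A)"
proof -
  let ?G = "\<lambda>k. expect (pair_law k) (\<lambda>(s, s'). log 2 (completions (or_list s s')))"
  have "(\<Sum>k<n. expect (pair_law k) (\<lambda>(s, s'). binary_entropy (\<psi> (next_prob s) (next_prob s'))))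
      \<le> (\<Sum>k<n. ?G k - ?G (Suc k))"
    by (intro sum_mono or_entropy_step) simp
  also have "\<dots> = ?G 0 - ?G n" by (rule sum_lessThan_telescope')
  also have "\<dots> \<le> ?G 0"
  proof -
    have "0 \<le> ?G n"
    proof (rule expect_nonneg, clarify)
      fix s s' assume "(s, s') \<in> set_pmf (pair_law n)"
      from completions_or_pos[OF this] show "0 \<le> log 2 (completions (or_list s s'))" by simp
    qed
    then show ?thesis by simp
  qed
  also have "?G 0 = log 2 (card A)" by (simp add: or_list_def completions_0)
  finally show ?thesis .
qed

end

section \<open>Combining the independent and the median coupling\<close>

context or_family
begin

interpretation indep: or_family_coupling n A "\<lambda>p q. p + q - p * q"
  by unfold_locales (use or_prob_bounds in \<open>auto simp: mult.commute\<close>)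

interpretation phi: or_family_coupling n A phi1
  by unfold_locales (use phi1_bounds phi1_commute in auto)

text \<open>With OR-probability \<open>p + q - p q\<close> the coupled bits are independent at every step, hence so are
  the two sequences.\<close>

lemma indep_pair_law: "indep.pair_law k = pair_pmf (prefix_law k) (prefix_law k)"
proof (induction k)
  case (Suc k)
  have "indep.pair_law (Suc k) = prefix_law k \<bind> (\<lambda>s. prefix_law k \<bind> (\<lambda>s'.
     bernoulli_pmf (next_prob s) \<bind> (\<lambda>b. bernoulli_pmf (next_prob s') \<bind> (\<lambda>b'. return_pmf (s @ [b], s' @ [b'])))))"
    by (simp add: Suc indep.kernel_def or_coupling_independent next_prob_bounds pair_pmf_def map_pmf_def
        bind_assoc_pmf bind_return_pmf)
  also have "\<dots> = pair_pmf (prefix_law (Suc k)) (prefix_law (Suc k))"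
    unfolding prefix_law_Suc
    by (simp add: pair_pmf_def map_pmf_def bind_assoc_pmf bind_return_pmf
        bind_commute_pmf[of "prefix_law k" "bernoulli_pmf _"])
  finally show ?case .
qed (simp add: prefix_law_0)

text \<open>The joint law of the two conditional probabilities before coordinate \<open>k + 1\<close> is revealed, under
  the coupling with OR-probability \<open>phi1\<close>. These are the laws to which the hypothesis on
  \<open>Gamma_hat\<close> is applied.\<close>

definition step_law :: "nat \<Rightarrow> (real \<times> real) pmf" where
  "step_law k = map_pmf (\<lambda>(s, s'). (next_prob s, next_prob s')) (phi.pair_law k)"

lemma marginal_step_law: "marginal (step_law k) = map_pmf next_prob (prefix_law k)"
proof -
  have "marginal (step_law k) = map_pmf next_prob (map_pmf fst (phi.pair_law k))"
    by (simp add: marginal_def step_law_def map_pmf_comp split_def)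
  then show ?thesis by (simp add: phi.map_fst_pair_law)
qed

lemma mean_entropy_step_law: "mean_entropy (step_law k) = expect (prefix_law k) (\<lambda>s. binary_entropy (next_prob s))"
  by (simp add: mean_entropy_def marginal_step_law)

lemma g_fun_step_law:
  "g_fun (step_law k) \<alpha> =
     (1 - \<alpha>) * expect (indep.pair_law k) (\<lambda>(s, s'). binary_entropy (next_prob s + next_prob s' - next_prob s * next_prob s'))
     + \<alpha> * expect (phi.pair_law k) (\<lambda>(s, s'). binary_entropy (phi1 (next_prob s) (next_prob s')))"
  unfolding g_fun_def marginal_step_law indep_pair_law map_pair[symmetric]
  by (simp add: step_law_def split_def)

lemma sum_g_fun_le:
  assumes "0 \<le> \<alpha>" "\<alpha> \<le> 1"
  shows "(\<Sum>k<n. g_fun (step_law k) \<alpha>) \<le> log 2 (card A)"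
proof -
  have "(\<Sum>k<n. g_fun (step_law k) \<alpha>) \<le> (1 - \<alpha>) * log 2 (card A) + \<alpha> * log 2 (card A)"
    unfolding g_fun_step_law sum.distrib sum_distrib_left[symmetric]
    using assms by (intro add_mono mult_left_mono indep.or_entropy_sum_le phi.or_entropy_sum_le) auto
  then show ?thesis by (simp add: algebra_simps)
qed

lemma finite_step_law: "finite (set_pmf (step_law k))"
  by (simp add: step_law_def phi.finite_pair_law)

lemma step_law_unit: "set_pmf (step_law k) \<subseteq> {0..1} \<times> {0..1}"
  by (auto simp: step_law_def next_prob_bounds)

lemma step_law_swap: "map_pmf prod.swap (step_law k) = step_law k"
proof -
  have "map_pmf prod.swap (step_law k)
      = map_pmf (\<lambda>(s, s'). (next_prob s, next_prob s')) (map_pmf prod.swap (phi.pair_law k))"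
    by (simp add: step_law_def map_pmf_comp split_def prod.swap_def)
  then show ?thesis by (simp add: phi.pair_law_swap step_law_def)
qed

text \<open>The mean of a conditional probability is the unconditional frequency of that coordinate.\<close>

lemma expect_step_law_le:
  assumes "k < n"
  shows "expect (step_law k) fst \<le> max_freq n A"
proof -
  have "expect (step_law k) fst = expect (prefix_law k) next_prob"
    using expect_marginal[of "step_law k" "\<lambda>p. p"] by (simp add: marginal_step_law)
  also have "\<dots> \<le> max_freq n A"
    unfolding expect_next_prob max_freq_def using assms by (intro Max_ge) auto
  finally show ?thesis .
qed

text \<open>The uniform law on one element has zero entropy, so the entropy argument says nothing there; but a
  nonzero element has a coordinate that is always 1.\<close>

lemma max_freq_singleton:
  assumes A: "A = {x}" and "x \<noteq> zero_vec n"
  shows "1 \<le> max_freq n A"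
proof -
  have x: "x \<in> cube n" using A A_cube by simp
  have "\<exists>i\<in>{1..n}. x i"
  proof (rule ccontr)
    assume "\<not> ?thesis"
    then have "x = zero_vec n"
      using x unfolding cube_def zero_vec_def by (intro PiE_ext[of _ "{1..n}"]) auto
    then show False using assms by simp
  qed
  then obtain i where i: "i \<in> {1..n}" "x i" by blast
  then have "measure_pmf.prob (pmf_of_set A) {x. x i} = 1"
    unfolding A by (simp add: pmf_of_set_singleton)
  then show ?thesis unfolding max_freq_def using i by (metis Max_ge finite_imageI finite_atLeastAtMost imageI)
qed

end

theorem corollary1:
  fixes n :: nat and t :: real and A :: "(nat \<Rightarrow> bool) set"
  assumes "n \<ge> 1"
    and "0 < t" and "t < 1/2"
    and "Gamma_hat t > 1"
    and "A \<subseteq> cube n" and "A \<noteq> {}" and "or_closed n A"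
    and "A \<noteq> {zero_vec n}"
  shows "max_freq n A \<ge> t"
proof (rule ccontr)
  assume "\<not> ?thesis"
  then have small: "max_freq n A < t" by simp
  interpret or_family n A by unfold_locales (use assms in auto)
  obtain \<alpha> c where \<alpha>: "0 \<le> \<alpha>" "\<alpha> \<le> 1" and c: "1 < c"
    and adm: "\<And>P. P \<in> admissible t \<Longrightarrow> c * mean_entropy P \<le> g_fun P \<alpha>"
    using Gamma_hat_witness[OF assms(4)] by blast
  have t: "0 < t" "t < 1" using assms by auto
  \<comment> \<open>At least two elements make the entropy \<open>log 2 (card A)\<close> positive, so the factor \<open>c > 1\<close> is contradictory.\<close>
  have "\<nexists>x. A = {x}"
    using max_freq_singleton small t assms(8) by fastforce
  then have "card A \<noteq> 1" "card A \<noteq> 0"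
    using finite_A A_ne by (auto simp: card_1_singleton_iff)
  then have pos: "0 < log 2 (card A)" by simp
  have "c * log 2 (card A) = (\<Sum>k<n. c * mean_entropy (step_law k))"
    unfolding entropy_chain_rule[symmetric] mean_entropy_step_law sum_distrib_left ..
  also have "\<dots> \<le> (\<Sum>k<n. g_fun (step_law k) \<alpha>)"
  proof (intro sum_mono)
    fix k assume "k \<in> {..<n}"
    then have "expect (step_law k) fst < t" using expect_step_law_le[of k] small by simp
    then show "c * mean_entropy (step_law k) \<le> g_fun (step_law k) \<alpha>"
      by (intro g_ge_mean_entropy[OF t \<alpha> adm] finite_step_law step_law_unit step_law_swap)
  qed
  also have "\<dots> \<le> log 2 (card A)" by (rule sum_g_fun_le[OF \<alpha>])
  finally show False using c pos by simp
qed

end
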